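(* Suppose $Z\to X$ is a finite regular cover of finite connected graphs, and that some primitive loop in $X$ lifts (with degree $1$) to $Z$. Then $$H_1^{\mathrm{prim}}(Z;\mathbb{C})=H_1(Z;\mathbb{C}).$$
   Context: A loop in $X$ is primitive if it represents an element of the free group $\pi_1(X)$ that is part of a free basis. A loop lifts with degree $1$ if the loop itself (not only a proper power) lifts to a closed loop. An elevation to $Z$ of a loop $\gamma$ in $X$ is a closed lift to $Z$ of the smallest power $\gamma^k$, $k\ge1$, that lifts to a closed loop. The primitive homology $H_1^{\mathrm{prim}}(Z;\mathbb{C})\subseteq H_1(Z;\mathbb{C})$ is the $\mathbb{C}$-span of the homology classes of all elevations of primitive loops in $X$. *)

theory Defs
  imports
    "Graph_Theory.Graph_Theory"
    "HOL-Algebra.Group"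
    "HOL-Library.Function_Algebras"
    Complex_Main
begin

text \<open>
  A graph (loops and multiple edges allowed) is given in the sense of Serre, by the locale
  \<^locale>\<open>bidirected_digraph\<close>: each geometric edge is a pair of distinct arcs \<open>a\<close>, \<open>rv a\<close> with
  opposite orientations. A loop with base vertex \<open>x\<close> is a closed arc walk \<open>awalk x p x\<close>, which need
  not be reduced; every loop in the geometric realisation is freely homotopic to one of these.
\<close>

definition finite_connected_graph :: "('a, 'b) pre_digraph \<Rightarrow> ('b \<Rightarrow> 'b) \<Rightarrow> bool" where
  "finite_connected_graph G rv \<longleftrightarrow>
     bidirected_digraph G rv \<and> fin_digraph G \<and> Digraph_Component.connected G"

subsection \<open>Fundamental group and primitive loops\<close>

definition loops :: "('a, 'b) pre_digraph \<Rightarrow> 'a \<Rightarrow> 'b list set" where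
  "loops G x = {p. pre_digraph.awalk G x p x}"

inductive loop_homotopic ::
  "('a, 'b) pre_digraph \<Rightarrow> ('b \<Rightarrow> 'b) \<Rightarrow> 'a \<Rightarrow> 'b list \<Rightarrow> 'b list \<Rightarrow> bool"
  for G rv x where
  refl: "p \<in> loops G x \<Longrightarrow> loop_homotopic G rv x p p"
| backtrack: "p @ q \<in> loops G x \<Longrightarrow> p @ [a, rv a] @ q \<in> loops G x \<Longrightarrow>
    loop_homotopic G rv x (p @ q) (p @ [a, rv a] @ q)"
| sym: "loop_homotopic G rv x p q \<Longrightarrow> loop_homotopic G rv x q p"
| trans: "loop_homotopic G rv x p q \<Longrightarrow> loop_homotopic G rv x q r \<Longrightarrow> loop_homotopic G rv x p r"

definition loop_class ::
  "('a, 'b) pre_digraph \<Rightarrow> ('b \<Rightarrow> 'b) \<Rightarrow> 'a \<Rightarrow> 'b list \<Rightarrow> 'b list set" where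
  "loop_class G rv x p = {q. loop_homotopic G rv x p q}"

definition pi1 :: "('a, 'b) pre_digraph \<Rightarrow> ('b \<Rightarrow> 'b) \<Rightarrow> 'a \<Rightarrow> 'b list set monoid" where
  "pi1 G rv x =
     \<lparr> carrier = loop_class G rv x ` loops G x,
       mult = (\<lambda>A B. \<Union>p\<in>A. \<Union>q\<in>B. loop_class G rv x (p @ q)),
       one = loop_class G rv x [] \<rparr>"

text \<open>
  Words over \<open>S\<close> and formal inverses: the letter \<open>(s, True)\<close> is \<open>s\<close>, the letter \<open>(s, False)\<close> is
  the inverse of \<open>s\<close>. The set \<open>S\<close> is a free basis if each group element is the value of exactly one
  reduced word.
\<close>

definition reduced_words :: "'g set \<Rightarrow> ('g \<times> bool) list set" where
  "reduced_words S =
     {w. set w \<subseteq> S \<times> UNIV \<and> successively (\<lambda>(s, b) (t, c). s = t \<longrightarrow> b = c) w}"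

fun word_value :: "('g, 'm) monoid_scheme \<Rightarrow> ('g \<times> bool) list \<Rightarrow> 'g" where
  "word_value H [] = \<one>\<^bsub>H\<^esub>"
| "word_value H ((s, b) # w) = (if b then s else inv\<^bsub>H\<^esub> s) \<otimes>\<^bsub>H\<^esub> word_value H w"

definition free_basis :: "('g, 'm) monoid_scheme \<Rightarrow> 'g set \<Rightarrow> bool" where
  "free_basis H S \<longleftrightarrow>
     S \<subseteq> carrier H \<and> bij_betw (word_value H) (reduced_words S) (carrier H)"

definition primitive_loop ::
  "('a, 'b) pre_digraph \<Rightarrow> ('b \<Rightarrow> 'b) \<Rightarrow> 'a \<Rightarrow> 'b list \<Rightarrow> bool" where
  "primitive_loop G rv x p \<longleftrightarrow>
     p \<in> loops G x \<and> (\<exists>S. free_basis (pi1 G rv x) S \<and> loop_class G rv x p \<in> S)"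

subsection \<open>Covers and elevations\<close>

text \<open>A graph map is a pair of a map on vertices and a map on arcs.\<close>

definition graph_map ::
  "('c, 'd) pre_digraph \<Rightarrow> ('d \<Rightarrow> 'd) \<Rightarrow> ('a, 'b) pre_digraph \<Rightarrow> ('b \<Rightarrow> 'b) \<Rightarrow>
   ('c \<Rightarrow> 'a) \<times> ('d \<Rightarrow> 'b) \<Rightarrow> bool" where
  "graph_map Z rz X rx f \<longleftrightarrow>
     (\<forall>z\<in>verts Z. fst f z \<in> verts X) \<and>
     (\<forall>e\<in>arcs Z. snd f e \<in> arcs X \<and> tail X (snd f e) = fst f (tail Z e) \<and>
        head X (snd f e) = fst f (head Z e) \<and> snd f (rz e) = rx (snd f e))"

definition covering_map ::
  "('c, 'd) pre_digraph \<Rightarrow> ('d \<Rightarrow> 'd) \<Rightarrow> ('a, 'b) pre_digraph \<Rightarrow> ('b \<Rightarrow> 'b) \<Rightarrow>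
   ('c \<Rightarrow> 'a) \<times> ('d \<Rightarrow> 'b) \<Rightarrow> bool" where
  "covering_map Z rz X rx f \<longleftrightarrow>
     graph_map Z rz X rx f \<and> fst f ` verts Z = verts X \<and>
     (\<forall>z\<in>verts Z. bij_betw (snd f) (out_arcs Z z) (out_arcs X (fst f z)))"

definition deck_transformation ::
  "('c, 'd) pre_digraph \<Rightarrow> ('d \<Rightarrow> 'd) \<Rightarrow> ('c \<Rightarrow> 'a) \<times> ('d \<Rightarrow> 'b) \<Rightarrow>
   ('c \<Rightarrow> 'c) \<times> ('d \<Rightarrow> 'd) \<Rightarrow> bool" where
  "deck_transformation Z rz f g \<longleftrightarrow>
     graph_map Z rz Z rz g \<and>
     bij_betw (fst g) (verts Z) (verts Z) \<and> bij_betw (snd g) (arcs Z) (arcs Z) \<and>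
     (\<forall>z\<in>verts Z. fst f (fst g z) = fst f z) \<and> (\<forall>e\<in>arcs Z. snd f (snd g e) = snd f e)"

definition regular_cover ::
  "('c, 'd) pre_digraph \<Rightarrow> ('d \<Rightarrow> 'd) \<Rightarrow> ('a, 'b) pre_digraph \<Rightarrow> ('b \<Rightarrow> 'b) \<Rightarrow>
   ('c \<Rightarrow> 'a) \<times> ('d \<Rightarrow> 'b) \<Rightarrow> bool" where
  "regular_cover Z rz X rx f \<longleftrightarrow>
     covering_map Z rz X rx f \<and>
     (\<forall>z\<in>verts Z. \<forall>z'\<in>verts Z. fst f z = fst f z' \<longrightarrow>
        (\<exists>g. deck_transformation Z rz f g \<and> fst g z = z'))"

definition closed_lift ::
  "('c, 'd) pre_digraph \<Rightarrow> ('c \<Rightarrow> 'a) \<times> ('d \<Rightarrow> 'b) \<Rightarrow> 'a \<Rightarrow> 'b list \<Rightarrow> 'c \<Rightarrow> 'd list \<Rightarrow> bool"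
  where
  "closed_lift Z f x p z q \<longleftrightarrow> q \<in> loops Z z \<and> fst f z = x \<and> map (snd f) q = p"

definition loop_power :: "'b list \<Rightarrow> nat \<Rightarrow> 'b list" where
  "loop_power p k = concat (replicate k p)"

text \<open>
  The exponent \<open>k\<close> is the least for which some lift of the power closes up; in a regular cover it does
  not depend on the start vertex of the lift.
\<close>

definition elevation ::
  "('c, 'd) pre_digraph \<Rightarrow> ('c \<Rightarrow> 'a) \<times> ('d \<Rightarrow> 'b) \<Rightarrow> 'a \<Rightarrow> 'b list \<Rightarrow> 'd list \<Rightarrow> bool" where
  "elevation Z f x p q \<longleftrightarrow>
     (\<exists>k\<ge>1. (\<exists>z. closed_lift Z f x (loop_power p k) z q) \<and>
        (\<forall>j. 1 \<le> j \<and> j < k \<longrightarrow> \<not> (\<exists>z' q'. closed_lift Z f x (loop_power p j) z' q')))"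

subsection \<open>Homology with complex coefficients\<close>

text \<open>
  A 1-chain is a function \<open>c\<close> on arcs with \<open>c (rv a) = - c a\<close>, where \<open>c a\<close> is the coefficient of the
  edge oriented as \<open>a\<close>. An edge with chosen orientation \<open>a\<close> contributes \<open>c a\<close> to the boundary at
  \<open>head G a\<close> and \<open>- c a = c (rv a)\<close> at \<open>tail G a = head G (rv a)\<close>; so the boundary at \<open>v\<close> is the sum
  of \<open>c\<close> over all arcs with head \<open>v\<close>. As a graph has no 2-cells, \<open>H\<^sub>1\<close> is the kernel of the boundary.
\<close>

definition chains1 :: "('a, 'b) pre_digraph \<Rightarrow> ('b \<Rightarrow> 'b) \<Rightarrow> ('b \<Rightarrow> complex) set" where
  "chains1 G rv = {c. (\<forall>a. a \<notin> arcs G \<longrightarrow> c a = 0) \<and> (\<forall>a\<in>arcs G. c (rv a) = - c a)}"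

definition boundary1 :: "('a, 'b) pre_digraph \<Rightarrow> ('b \<Rightarrow> complex) \<Rightarrow> 'a \<Rightarrow> complex" where
  "boundary1 G c v = (\<Sum>a\<in>in_arcs G v. c a)"

definition H1 :: "('a, 'b) pre_digraph \<Rightarrow> ('b \<Rightarrow> 'b) \<Rightarrow> ('b \<Rightarrow> complex) set" where
  "H1 G rv = {c \<in> chains1 G rv. \<forall>v\<in>verts G. boundary1 G c v = 0}"

definition homology_class :: "('b \<Rightarrow> 'b) \<Rightarrow> 'b list \<Rightarrow> 'b \<Rightarrow> complex" where
  "homology_class rv q = (\<lambda>a. of_nat (count_list q a) - of_nat (count_list q (rv a)))"

definition complex_span :: "('b \<Rightarrow> complex) set \<Rightarrow> ('b \<Rightarrow> complex) set" where
  "complex_span = module.span (\<lambda>(k::complex) c a. k * c a)"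

definition H1_prim ::
  "('c, 'd) pre_digraph \<Rightarrow> ('d \<Rightarrow> 'd) \<Rightarrow> ('a, 'b) pre_digraph \<Rightarrow> ('b \<Rightarrow> 'b) \<Rightarrow>
   ('c \<Rightarrow> 'a) \<times> ('d \<Rightarrow> 'b) \<Rightarrow> ('d \<Rightarrow> complex) set" where
  "H1_prim Z rz X rx f =
     complex_span {homology_class rz q | q x p. primitive_loop X rx x p \<and> elevation Z f x p q}"

end

theory Submission
  imports Defs
begin

text \<open>
  Let \<open>p\<close> be a primitive loop at \<open>x\<close> with a closed lift, and let \<open>a\<close> be its class, a member of a free
  basis \<open>S\<close> of the fundamental group of \<open>X\<close>. The cover is regular, so all lifts of \<open>p\<close> are closed and
  their homology classes are primitive.

  The homology of the connected graph \<open>Z\<close> is spanned by loops based at one vertex \<open>z\<close> over \<open>x\<close> (lemma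
  \<open>H1_eq_span_loops\<close>). Such a loop projects to an element of the fundamental group of \<open>X\<close>, and this
  element is a word in \<open>S\<close>. Deleting all letters \<open>a\<close> from the word removes only closed lifts of \<open>p\<close>
  and of its reverse from the loop (lemma \<open>lift_class_delete_letter\<close>); so the class of the loop changes
  by primitive homology, and a loop that lifts a word \<open>w\<close> in \<open>S - {a}\<close> remains. Replacing \<open>a\<close> by \<open>a w\<close>
  turns \<open>S\<close> into another free basis (lemma \<open>free_basis_transvection\<close>), so \<open>a w\<close> is primitive. Both \<open>a\<close>
  and \<open>a w\<close> have closed lifts at \<open>z\<close>, and \<open>[w] = [a w] - [a]\<close> in homology. Hence every loop at \<open>z\<close> has
  its class in the primitive homology (lemma \<open>loop_in_H1_prim\<close>).

  Lifts are handled through their end point and their chain only, as these are invariant under homotopy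
  of the projected loop (lemma \<open>lift_class_homotopic\<close>).
\<close>

section \<open>Free bases and transvections\<close>

definition map_letters :: "('g \<Rightarrow> 'h) \<Rightarrow> ('g \<times> bool) list \<Rightarrow> ('h \<times> bool) list" where
  "map_letters g = map (\<lambda>(s, b). (g s, b))"

lemma map_letters_simps [simp]:
  "map_letters g [] = []"
  "map_letters g ((s, b) # w) = (g s, b) # map_letters g w"
  by (simp_all add: map_letters_def)

lemma map_letters_cong:
  "set w \<subseteq> S \<times> UNIV \<Longrightarrow> (\<And>s. s \<in> S \<Longrightarrow> g s = h s) \<Longrightarrow> map_letters g w = map_letters h w"
  by (auto simp: map_letters_def)

lemma set_map_letters: "set w \<subseteq> S \<times> UNIV \<Longrightarrow> set (map_letters g w) \<subseteq> g ` S \<times> UNIV"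
  by (auto simp: map_letters_def)

lemma map_letters_append: "map_letters g (u @ v) = map_letters g u @ map_letters g v"
  by (simp add: map_letters_def)

text \<open>
  Free reduction is a function on words that knows no group. One reduced form therefore serves
  simultaneously for all evaluations of the letters, which is what makes the extension of a map from
  a free basis to a homomorphism well defined.
\<close>

fun reduce_word :: "('g \<times> bool) list \<Rightarrow> ('g \<times> bool) list" where
  "reduce_word [] = []"
| "reduce_word (x # w) =
     (case reduce_word w of
        [] \<Rightarrow> [x]
      | y # v \<Rightarrow> if fst x = fst y \<and> snd x \<noteq> snd y then v else x # y # v)"

lemma reduce_word_in_reduced_words:
  "set w \<subseteq> S \<times> UNIV \<Longrightarrow> reduce_word w \<in> reduced_words S"
proof (induction w)
  case (Cons x w)
  then have "reduce_word w \<in> reduced_words S" "x \<in> S \<times> UNIV" by auto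
  then show ?case
    by (auto simp: reduced_words_def successively_Cons split: list.split)
qed (simp add: reduced_words_def)

context group
begin

lemma word_value_closed [simp]:
  "set w \<subseteq> carrier G \<times> UNIV \<Longrightarrow> word_value G w \<in> carrier G"
  by (induction w) auto

lemma word_value_append:
  "set u \<subseteq> carrier G \<times> UNIV \<Longrightarrow> set v \<subseteq> carrier G \<times> UNIV \<Longrightarrow>
    word_value G (u @ v) = word_value G u \<otimes> word_value G v"
  by (induction u) (auto simp: m_assoc)

lemma word_value_reduce_word:
  assumes "g ` S \<subseteq> carrier G" "set w \<subseteq> S \<times> UNIV"
  shows "word_value G (map_letters g (reduce_word w)) = word_value G (map_letters g w)"
  using assms(2)
proof (induction w)
  case (Cons x w)
  obtain s b where x: "x = (s, b)" by (cases x)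
  have s: "g s \<in> carrier G" using Cons.prems assms(1) x by auto
  have IH: "word_value G (map_letters g (reduce_word w)) = word_value G (map_letters g w)"
    using Cons by auto
  have red: "set (reduce_word w) \<subseteq> S \<times> UNIV"
    using reduce_word_in_reduced_words[of w S] Cons.prems by (auto simp: reduced_words_def)
  show ?case
  proof (cases "reduce_word w")
    case Nil
    then show ?thesis using IH x by simp
  next
    case (Cons y v)
    obtain t c where y: "y = (t, c)" by (cases y)
    have v: "word_value G (map_letters g v) \<in> carrier G"
      using red Cons set_map_letters[of v S g] assms(1) by (intro word_value_closed) auto
    show ?thesis
      using IH[symmetric] Cons x y s v by (auto simp: m_assoc[symmetric])
  qed
qed simp

lemma word_value_hom:
  assumes "group K" "h \<in> hom G K" "set w \<subseteq> carrier G \<times> UNIV"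
  shows "h (word_value G w) = word_value K (map_letters h w)"
proof -
  interpret K: group K by fact
  interpret h: group_hom G K h by unfold_locales fact
  show ?thesis using assms(3) by (induction w) (auto simp: h.hom_inv)
qed

text \<open>
  The universal property of a free basis. The extension evaluates the reduced word of an element in
  \<open>K\<close>. It is multiplicative because the reduced word of a product is the free reduction of the
  concatenated words, and free reduction does not change values in \<open>K\<close>.
\<close>

lemma free_basis_extend:
  assumes S: "free_basis G S" and K: "group K" and g: "g ` S \<subseteq> carrier K"
  shows "\<exists>h\<in>hom G K. \<forall>w. set w \<subseteq> S \<times> UNIV \<longrightarrow>
           h (word_value G w) = word_value K (map_letters g w)"
proof -
  interpret K: group K by fact
  have SC: "S \<subseteq> carrier G" and bij: "bij_betw (word_value G) (reduced_words S) (carrier G)"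
    using S by (auto simp: free_basis_def)
  define nf where "nf = inv_into (reduced_words S) (word_value G)"
  define h where "h x = word_value K (map_letters g (nf x))" for x
  have nf: "nf x \<in> reduced_words S" "word_value G (nf x) = x" if "x \<in> carrier G" for x
    using that bij unfolding nf_def bij_betw_def
    by (simp_all add: inv_into_into f_inv_into_f)
  have red: "set w \<subseteq> S \<times> UNIV" if "w \<in> reduced_words S" for w
    using that by (simp add: reduced_words_def)
  have id: "map_letters (\<lambda>x. x) w = w" for w :: "('a \<times> bool) list" by (simp add: map_letters_def)
  have nf_word: "nf (word_value G w) = reduce_word w" if w: "set w \<subseteq> S \<times> UNIV" for w
  proof -
    have "word_value G (reduce_word w) = word_value G w"
      using word_value_reduce_word[of "\<lambda>x. x" S w] SC w by (simp add: id)
    then show ?thesis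
      using bij reduce_word_in_reduced_words[OF w] unfolding nf_def bij_betw_def
      by (metis inv_into_f_f)
  qed
  have h_word: "h (word_value G w) = word_value K (map_letters g w)" if "set w \<subseteq> S \<times> UNIV" for w
    using that g by (simp add: h_def nf_word K.word_value_reduce_word)
  have gS: "set (map_letters g w) \<subseteq> carrier K \<times> UNIV" if "set w \<subseteq> S \<times> UNIV" for w
    using set_map_letters[OF that, of g] g by auto
  have "h \<in> hom G K"
  proof (rule homI)
    fix x y assume x: "x \<in> carrier G" and y: "y \<in> carrier G"
    show "h x \<in> carrier K" using nf(1)[OF x] by (simp add: h_def gS red)
    have "x \<otimes> y = word_value G (nf x @ nf y)"
      using nf[OF x] nf[OF y] red SC by (subst word_value_append) fastforce+
    also have "h \<dots> = word_value K (map_letters g (nf x @ nf y))"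
      using nf x y red by (intro h_word) auto
    also have "\<dots> = h x \<otimes>\<^bsub>K\<^esub> h y"
      using nf x y by (simp add: h_def map_letters_append K.word_value_append gS red)
    finally show "h (x \<otimes> y) = h x \<otimes>\<^bsub>K\<^esub> h y" .
  qed
  with h_word show ?thesis by blast
qed

lemma free_basis_iso_image:
  assumes S: "free_basis G S" and K: "group K" and h: "h \<in> iso G K"
  shows "free_basis K (h ` S)"
proof -
  have SC: "S \<subseteq> carrier G" and bij: "bij_betw (word_value G) (reduced_words S) (carrier G)"
    using S by (auto simp: free_basis_def)
  have hom: "h \<in> hom G K" and bij_h: "bij_betw h (carrier G) (carrier K)"
    using h by (auto simp: iso_def)
  have inj: "inj_on h S" using bij_h SC by (meson bij_betw_def inj_on_subset)
  have bij_red: "bij_betw (map_letters h) (reduced_words S) (reduced_words (h ` S))"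
  proof (rule bij_betw_byWitness[where f' = "map_letters (inv_into S h)"])
    have succ: "map_letters k w \<in> reduced_words (k ` T)" if "inj_on k T" "w \<in> reduced_words T"
      for k :: "'x \<Rightarrow> 'y" and T w
    proof -
      have sub: "set w \<subseteq> T \<times> UNIV" and red: "successively (\<lambda>(s, b) (t, c). s = t \<longrightarrow> b = c) w"
        using that(2) by (auto simp: reduced_words_def)
      from red have "successively (\<lambda>(s, b) (t, c). s = t \<longrightarrow> b = c) (map_letters k w)"
        unfolding map_letters_def successively_map
        by (rule successively_mono) (use sub that(1) in \<open>auto dest: inj_onD\<close>)
      with set_map_letters[OF sub] show ?thesis by (simp add: reduced_words_def)
    qed
    have inv: "inj_on (inv_into S h) (h ` S)" by (simp add: inj_on_inv_into)
    have im: "inv_into S h ` h ` S = S" using inj by simp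
    show "map_letters h ` reduced_words S \<subseteq> reduced_words (h ` S)" using succ[OF inj] by auto
    show "map_letters (inv_into S h) ` reduced_words (h ` S) \<subseteq> reduced_words S"
      using succ[OF inv] im by auto
    show "\<forall>w\<in>reduced_words S. map_letters (inv_into S h) (map_letters h w) = w"
      using inj by (auto simp: map_letters_def reduced_words_def o_def intro!: map_idI)
    show "\<forall>w\<in>reduced_words (h ` S). map_letters h (map_letters (inv_into S h) w) = w"
      by (force simp: map_letters_def reduced_words_def o_def f_inv_into_f intro!: map_idI)
  qed
  have "bij_betw (word_value K \<circ> map_letters h) (reduced_words S) (carrier K)"
  proof (subst bij_betw_cong)
    show "(word_value K \<circ> map_letters h) w = (h \<circ> word_value G) w" if "w \<in> reduced_words S" for w
      using that SC by (auto simp: reduced_words_def intro!: word_value_hom[OF K hom, symmetric])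
  qed (rule bij_betw_trans[OF bij bij_h])
  then have "bij_betw (word_value K) (reduced_words (h ` S)) (carrier K)"
    using bij_betw_comp_iff[OF bij_red] by blast
  moreover have "h ` S \<subseteq> carrier K" using SC bij_h by (auto simp: bij_betw_def)
  ultimately show ?thesis by (simp add: free_basis_def)
qed

text \<open>
  The maps fixing \<open>S - {a}\<close> and sending \<open>a\<close> to \<open>a v\<close>, respectively to \<open>a v\<^sup>-\<^sup>1\<close>, where \<open>v\<close> is the value
  of \<open>w\<close>, extend to endomorphisms. Both fix \<open>v\<close>, a product of letters other than \<open>a\<close>, so they are
  inverse to each other on \<open>S\<close> and hence everywhere. The new basis is the image of \<open>S\<close> under the
  first of these automorphisms.
\<close>

lemma free_basis_transvection:
  assumes S: "free_basis G S" and a: "a \<in> S" and w: "set w \<subseteq> (S - {a}) \<times> UNIV"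
  shows "free_basis G (insert (a \<otimes> word_value G w) (S - {a}))"
proof -
  have SC: "S \<subseteq> carrier G" and bij: "bij_betw (word_value G) (reduced_words S) (carrier G)"
    using S by (auto simp: free_basis_def)
  define v where "v = word_value G w"
  have v: "v \<in> carrier G" using w SC unfolding v_def by (intro word_value_closed) auto
  have aC: "a \<in> carrier G" using a SC by auto
  have ext: "\<exists>h\<in>hom G G. h a = a \<otimes> x \<and> (\<forall>s\<in>S - {a}. h s = s) \<and> h v = v"
    if x: "x \<in> carrier G" for x
  proof -
    define g where "g = (\<lambda>s. s)(a := a \<otimes> x)"
    have gS: "g ` S \<subseteq> carrier G" using SC x aC by (auto simp: g_def)
    obtain h where h: "h \<in> hom G G"
      and hw: "\<And>w. set w \<subseteq> S \<times> UNIV \<Longrightarrow> h (word_value G w) = word_value G (map_letters g w)"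
      using free_basis_extend[OF S group_axioms gS] by blast
    have "h s = g s" if "s \<in> S" for s
      using hw[of "[(s, True)]"] that SC gS by (auto simp: subset_iff image_subset_iff)
    moreover have "map_letters g w = map_letters (\<lambda>s. s) w"
      using w by (intro map_letters_cong[of w "S - {a}"]) (auto simp: g_def)
    then have "h v = v"
      using hw[of w] w by (auto simp: v_def map_letters_def)
    ultimately show ?thesis using h a by (intro bexI[of _ h]) (auto simp: g_def)
  qed
  obtain h where h: "h \<in> hom G G" "h a = a \<otimes> v" "\<And>s. s \<in> S - {a} \<Longrightarrow> h s = s" "h v = v"
    using ext[OF v] by blast
  obtain k where k: "k \<in> hom G G" "k a = a \<otimes> inv v" "\<And>s. s \<in> S - {a} \<Longrightarrow> k s = s" "k v = v"
    using ext[of "inv v"] v by auto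
  interpret h: group_hom G G h by unfold_locales fact
  interpret k: group_hom G G k by unfold_locales fact
  have identity: "e x = x" if e: "e \<in> hom G G" "\<And>s. s \<in> S \<Longrightarrow> e s = s" and "x \<in> carrier G" for e x
  proof -
    obtain u where u: "u \<in> reduced_words S" "x = word_value G u"
      using \<open>x \<in> carrier G\<close> bij by (auto simp: bij_betw_def)
    then have sub: "set u \<subseteq> S \<times> UNIV" by (simp add: reduced_words_def)
    have "map_letters e u = map_letters (\<lambda>s. s) u" using sub e(2) by (rule map_letters_cong)
    then show ?thesis
      using u sub SC word_value_hom[OF group_axioms e(1), of u] by (auto simp: map_letters_def)
  qed
  have hk: "h (k x) = x" if "x \<in> carrier G" for x
  proof -
    have "(h \<circ> k) s = s" if "s \<in> S" for s
      using that h(2-4) k(2-4) v aC by (cases "s = a") (auto simp: h.hom_inv m_assoc)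
    then show ?thesis using identity[of "h \<circ> k" x] that Group.hom_compose[OF k(1) h(1)] by simp
  qed
  have kh: "k (h x) = x" if "x \<in> carrier G" for x
  proof -
    have "(k \<circ> h) s = s" if "s \<in> S" for s
      using that h(2-4) k(2-4) v aC by (cases "s = a") (auto simp: k.hom_inv m_assoc)
    then show ?thesis using identity[of "k \<circ> h" x] that Group.hom_compose[OF h(1) k(1)] by simp
  qed
  have "bij_betw h (carrier G) (carrier G)"
    by (rule bij_betw_byWitness[of _ k]) (auto simp: hk kh)
  then have "h \<in> iso G G" using h(1) by (simp add: iso_def)
  moreover have "h ` S = insert (a \<otimes> v) (S - {a})" using h(2,3) a by force
  ultimately show ?thesis
    using free_basis_iso_image[OF S group_axioms, of h] by (simp add: v_def)
qed

end

section \<open>The fundamental group of a graph\<close>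

context bidirected_digraph
begin

definition rev_walk :: "'b list \<Rightarrow> 'b list" where
  "rev_walk p = map arev (rev p)"

lemma rev_walk_simps [simp]:
  "rev_walk [] = []"
  "rev_walk (a # p) = rev_walk p @ [arev a]"
  "rev_walk (p @ q) = rev_walk q @ rev_walk p"
  by (simp_all add: rev_walk_def)

lemma rev_walk_rev_walk [simp]: "rev_walk (rev_walk p) = p"
  by (simp add: rev_walk_def rev_map o_def)

lemma awalk_append_iff_ex: "awalk x (p @ q) y \<longleftrightarrow> (\<exists>z. awalk x p z \<and> awalk z q y)"
  using awalk_appendI[of x p _ q y] awalk_append_iff[of x p q y] by blast

lemma awalk_rev_walk: "awalk x p y \<Longrightarrow> awalk y (rev_walk p) x"
proof (induction p arbitrary: x)
  case (Cons a p)
  then have "awalk y (rev_walk p) (head G a)" "a \<in> arcs G" "x = tail G a"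
    by (auto simp: awalk_Cons_iff)
  moreover from this have "awalk (head G a) [arev a] x" by (simp add: awalk_simps)
  ultimately show ?case by (auto simp del: awalk_append_iff intro: awalk_appendI)
qed (simp add: awalk_Nil_iff)

lemma awalk_end_unique: "awalk x p y \<Longrightarrow> awalk x p y' \<Longrightarrow> y = y'"
  by (induction p arbitrary: x) (auto simp: awalk_simps)

lemma loop_homotopic_loops:
  "loop_homotopic G arev x p q \<Longrightarrow> p \<in> loops G x \<and> q \<in> loops G x"
  by (induction rule: loop_homotopic.induct) auto

lemma loops_append: "p \<in> loops G x \<Longrightarrow> q \<in> loops G x \<Longrightarrow> p @ q \<in> loops G x"
  by (auto simp: loops_def awalk_append_iff_ex)

lemma loop_homotopic_append_left:
  assumes "loop_homotopic G arev x p p'" "q \<in> loops G x"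
  shows "loop_homotopic G arev x (q @ p) (q @ p')"
  using assms(1)
proof (induction rule: loop_homotopic.induct)
  case (backtrack u v a)
  then show ?case
    using loop_homotopic.backtrack[of "q @ u" v G x a] loops_append[OF assms(2)] by simp
qed (auto intro: loop_homotopic.intros loops_append assms(2))

lemma loop_homotopic_append_right:
  assumes "loop_homotopic G arev x p p'" "q \<in> loops G x"
  shows "loop_homotopic G arev x (p @ q) (p' @ q)"
  using assms(1)
proof (induction rule: loop_homotopic.induct)
  case (backtrack u v a)
  then show ?case
    using loop_homotopic.backtrack[of u "v @ q" G x a]
      loops_append[OF backtrack(1) assms(2)] loops_append[OF backtrack(2) assms(2)] by simp
qed (auto intro: loop_homotopic.intros loops_append assms(2))

lemma loop_homotopic_append:
  assumes "loop_homotopic G arev x p p'" "loop_homotopic G arev x q q'"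
  shows "loop_homotopic G arev x (p @ q) (p' @ q')"
proof (rule loop_homotopic.trans)
  show "loop_homotopic G arev x (p @ q) (p' @ q)"
    using assms loop_homotopic_loops by (intro loop_homotopic_append_right) blast+
  show "loop_homotopic G arev x (p' @ q) (p' @ q')"
    using assms loop_homotopic_loops by (intro loop_homotopic_append_left) blast+
qed

lemma loop_homotopic_rev_walk:
  assumes "p \<in> loops G x"
  shows "loop_homotopic G arev x (p @ rev_walk p) []"
proof -
  have "loop_homotopic G arev x (p @ rev_walk p) []" if "awalk x p y" for y
    using that
  proof (induction p arbitrary: y rule: rev_induct)
    case Nil
    then show ?case by (auto simp: loops_def awalk_simps intro: loop_homotopic.refl)
  next
    case (snoc a p)
    then have p: "awalk x p (tail G a)" and a: "a \<in> arcs G"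
      by (auto simp: awalk_append_iff_ex awalk_simps)
    have "p @ [a, arev a] @ rev_walk p \<in> loops G x" "p @ rev_walk p \<in> loops G x"
      using p a awalk_rev_walk[OF p]
      by (auto simp: loops_def awalk_append_iff_ex awalk_simps intro!: exI[of _ "tail G a"])
    then have "loop_homotopic G arev x (p @ rev_walk p) (p @ [a, arev a] @ rev_walk p)"
      by (intro loop_homotopic.backtrack)
    from loop_homotopic.trans[OF loop_homotopic.sym[OF this] snoc.IH[OF p]] show ?case
      by simp
  qed
  then show ?thesis using assms by (auto simp: loops_def)
qed

lemma loop_class_eq_iff:
  assumes "p \<in> loops G x"
  shows "loop_class G arev x p = loop_class G arev x q \<longleftrightarrow> loop_homotopic G arev x p q"
proof
  assume "loop_class G arev x p = loop_class G arev x q"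
  moreover have "p \<in> loop_class G arev x p" using assms by (simp add: loop_class_def loop_homotopic.refl)
  ultimately have "loop_homotopic G arev x q p" by (simp add: loop_class_def)
  then show "loop_homotopic G arev x p q" by (rule loop_homotopic.sym)
next
  assume "loop_homotopic G arev x p q"
  then show "loop_class G arev x p = loop_class G arev x q"
    unfolding loop_class_def by (blast intro: loop_homotopic.sym loop_homotopic.trans)
qed

text \<open>
  The product in \<^const>\<open>pi1\<close> is a union over all representatives; since concatenation respects
  homotopy, all members of the union coincide.
\<close>

lemma loop_class_mult:
  assumes "p \<in> loops G x" "q \<in> loops G x"
  shows "loop_class G arev x p \<otimes>\<^bsub>pi1 G arev x\<^esub> loop_class G arev x q = loop_class G arev x (p @ q)"
proof -
  have same: "loop_class G arev x (p' @ q') = loop_class G arev x (p @ q)"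
    if "p' \<in> loop_class G arev x p" "q' \<in> loop_class G arev x q" for p' q'
  proof -
    have "loop_homotopic G arev x (p @ q) (p' @ q')"
      using that by (intro loop_homotopic_append) (simp_all add: loop_class_def)
    then show ?thesis using loops_append[OF assms] loop_class_eq_iff by metis
  qed
  have "(\<Union>p'\<in>loop_class G arev x p. \<Union>q'\<in>loop_class G arev x q. loop_class G arev x (p' @ q')) =
      (\<Union>p'\<in>loop_class G arev x p. \<Union>q'\<in>loop_class G arev x q. loop_class G arev x (p @ q))"
    by (rule SUP_cong[OF HOL.refl], rule SUP_cong[OF HOL.refl], rule same)
  moreover have "p \<in> loop_class G arev x p" "q \<in> loop_class G arev x q"
    using assms by (simp_all add: loop_class_def loop_homotopic.refl)
  ultimately show ?thesis unfolding pi1_def by auto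
qed

lemma rev_walk_loops: "p \<in> loops G x \<Longrightarrow> rev_walk p \<in> loops G x"
  by (simp add: loops_def awalk_rev_walk)

lemma pi1_one: "\<one>\<^bsub>pi1 G arev x\<^esub> = loop_class G arev x []"
  by (simp add: pi1_def)

lemma pi1_carrier: "carrier (pi1 G arev x) = loop_class G arev x ` loops G x"
  by (simp add: pi1_def)

lemma loop_class_rev_walk_mult:
  assumes "p \<in> loops G x"
  shows "loop_class G arev x (rev_walk p) \<otimes>\<^bsub>pi1 G arev x\<^esub> loop_class G arev x p = \<one>\<^bsub>pi1 G arev x\<^esub>"
  using loop_homotopic_rev_walk[OF rev_walk_loops[OF assms]] assms rev_walk_loops[OF assms]
  by (simp add: loop_class_mult loops_append loop_class_eq_iff pi1_one)

lemma pi1_group: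
  assumes "x \<in> verts G"
  shows "group (pi1 G arev x)" (is "group ?H")
proof (rule groupI)
  have nil: "[] \<in> loops G x" using assms by (simp add: loops_def awalk_Nil_iff)
  then show "\<one>\<^bsub>?H\<^esub> \<in> carrier ?H" by (simp add: pi1_one pi1_carrier)
  fix A assume "A \<in> carrier ?H"
  then obtain p where p: "p \<in> loops G x" "A = loop_class G arev x p" by (auto simp: pi1_carrier)
  show "\<one>\<^bsub>?H\<^esub> \<otimes>\<^bsub>?H\<^esub> A = A" using p nil by (simp add: pi1_one loop_class_mult)
  show "\<exists>B\<in>carrier ?H. B \<otimes>\<^bsub>?H\<^esub> A = \<one>\<^bsub>?H\<^esub>"
    using p rev_walk_loops[OF p(1)] loop_class_rev_walk_mult[OF p(1)]
    by (intro bexI[of _ "loop_class G arev x (rev_walk p)"]) (simp_all add: pi1_carrier)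
  fix B assume "B \<in> carrier ?H"
  then obtain q where q: "q \<in> loops G x" "B = loop_class G arev x q" by (auto simp: pi1_carrier)
  show "A \<otimes>\<^bsub>?H\<^esub> B \<in> carrier ?H"
    using p q loops_append[OF p(1) q(1)] by (simp add: loop_class_mult pi1_carrier)
  fix C assume "C \<in> carrier ?H"
  then obtain r where r: "r \<in> loops G x" "C = loop_class G arev x r" by (auto simp: pi1_carrier)
  show "A \<otimes>\<^bsub>?H\<^esub> B \<otimes>\<^bsub>?H\<^esub> C = A \<otimes>\<^bsub>?H\<^esub> (B \<otimes>\<^bsub>?H\<^esub> C)"
    using p q r by (simp add: loop_class_mult loops_append)
qed

lemma loop_class_rev_walk:
  assumes "p \<in> loops G x"
  shows "loop_class G arev x (rev_walk p) = inv\<^bsub>pi1 G arev x\<^esub> loop_class G arev x p"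
proof -
  have "x \<in> verts G" using assms by (auto simp: loops_def)
  then interpret P: group "pi1 G arev x" by (rule pi1_group)
  show ?thesis
    using assms rev_walk_loops[OF assms] loop_class_rev_walk_mult[OF assms]
    by (intro P.inv_equality[symmetric]) (simp_all add: pi1_carrier)
qed

text \<open>
  The function \<open>\<rho>\<close> chooses a loop for each letter. The resulting loop is a representative of the
  value of the word in the fundamental group (lemma \<open>word_loop_class\<close> below).
\<close>

definition word_loop :: "('g \<Rightarrow> 'b list) \<Rightarrow> ('g \<times> bool) list \<Rightarrow> 'b list" where
  "word_loop \<rho> w = concat (map (\<lambda>(s, b). if b then \<rho> s else rev_walk (\<rho> s)) w)"

lemma word_loop_simps [simp]:
  "word_loop \<rho> [] = []"
  "word_loop \<rho> ((s, b) # w) = (if b then \<rho> s else rev_walk (\<rho> s)) @ word_loop \<rho> w"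
  by (simp_all add: word_loop_def)

lemma word_loop_class:
  assumes "x \<in> verts G" "\<And>s. s \<in> S \<Longrightarrow> \<rho> s \<in> loops G x \<and> loop_class G arev x (\<rho> s) = s"
    and "set w \<subseteq> S \<times> UNIV"
  shows "word_loop \<rho> w \<in> loops G x \<and>
         loop_class G arev x (word_loop \<rho> w) = word_value (pi1 G arev x) w"
  using assms(3)
proof (induction w)
  case Nil
  then show ?case using assms(1) by (simp add: loops_def awalk_Nil_iff pi1_one)
next
  case (Cons l w)
  obtain s b where l: "l = (s, b)" by (cases l)
  then have s: "\<rho> s \<in> loops G x" "loop_class G arev x (\<rho> s) = s" using Cons.prems assms(2) by auto
  then show ?case
    using Cons l loop_class_rev_walk[OF s(1)] rev_walk_loops[OF s(1)]
    by (auto simp: loop_class_mult[symmetric] loops_append)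
qed

end

section \<open>Homology of a connected graph\<close>

interpretation complex_chains: module "\<lambda>(k::complex) (c :: 'b \<Rightarrow> complex) a. k * c a"
  by unfold_locales (auto simp: fun_eq_iff algebra_simps)

context bidirected_digraph
begin

lemma homology_class_append:
  "homology_class arev (p @ q) = homology_class arev p + homology_class arev q"
  by (auto simp: homology_class_def)

lemma homology_class_arc:
  "homology_class arev [a] b = of_bool (b = a) - of_bool (b = arev a)"
  by (auto simp: homology_class_def)

lemma homology_class_rev_walk: "homology_class arev (rev_walk p) = - homology_class arev p"
proof (induction p)
  case (Cons a p)
  have "homology_class arev [arev a] = - homology_class arev [a]"
    by (simp add: homology_class_arc fun_eq_iff)
  then have "homology_class arev (rev_walk p @ [arev a]) = - homology_class arev ([a] @ p)"
    using Cons unfolding homology_class_append by (simp add: fun_eq_iff)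
  then show ?case by simp
qed (simp add: homology_class_def fun_eq_iff)

end

locale finite_bidirected_digraph = bidirected_digraph G arev + fin_digraph G for G arev
begin

lemma boundary1_homology_class:
  assumes "awalk x p y"
  shows "boundary1 G (homology_class arev p) v = of_bool (v = y) - of_bool (v = x)"
  using assms
proof (induction p arbitrary: x)
  case Nil
  then show ?case by (auto simp: boundary1_def homology_class_def awalk_Nil_iff)
next
  case (Cons a p)
  then have a: "a \<in> arcs G" "x = tail G a" and p: "awalk (head G a) p y"
    by (auto simp: awalk_Cons_iff)
  have fin: "finite (in_arcs G v)" by (rule finite_subset[of _ "arcs G"]) auto
  have "boundary1 G (homology_class arev [a]) v = of_bool (v = head G a) - of_bool (v = tail G a)"
    using a fin unfolding boundary1_def homology_class_arc sum_subtractf of_bool_def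
    by (subst (1 2) sum.delta) auto
  moreover have "boundary1 G (homology_class arev ([a] @ p)) v =
      boundary1 G (homology_class arev [a]) v + boundary1 G (homology_class arev p) v"
    unfolding homology_class_append by (simp add: boundary1_def sum.distrib)
  ultimately show ?case using Cons.IH[OF p] a by simp
qed

lemma homology_class_in_H1:
  assumes "p \<in> loops G x"
  shows "homology_class arev p \<in> H1 G arev"
proof -
  have p: "awalk x p x" using assms by (simp add: loops_def)
  have "count_list p a = 0" if "a \<notin> arcs G" for a
    using p that by (auto simp: count_list_0_iff dest: awalkE)
  then have "homology_class arev p \<in> chains1 G arev"
    by (auto simp: chains1_def homology_class_def arev_eq)
  then show ?thesis by (simp add: H1_def boundary1_homology_class[OF p])
qed

lemma subspace_H1: "complex_chains.subspace (H1 G arev)"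
  unfolding complex_chains.subspace_def H1_def chains1_def
  by (auto simp: boundary1_def sum.distrib sum_distrib_left[symmetric] algebra_simps)

lemma sum_arcs_by_head:
  "(\<Sum>a\<in>arcs G. g a) = (\<Sum>v\<in>verts G. \<Sum>a\<in>in_arcs G v. g a)"
  for g :: "'b \<Rightarrow> complex"
  unfolding in_arcs_def by (rule sum.group[symmetric]) auto

text \<open>
  Choose a walk \<open>T v\<close> from \<open>z\<close> to every vertex \<open>v\<close> and close each arc \<open>a\<close> up to the loop that runs
  along \<open>T (tail a)\<close>, then \<open>a\<close>, then back along \<open>T (head a)\<close>. The sum of these loops, weighted by \<open>c\<close>,
  counts every edge in both orientations, which accounts for the factor \<open>1/2\<close>. The walk \<open>T v\<close>
  contributes with the boundary of \<open>c\<close> at \<open>v\<close> as coefficient, up to sign, which is \<open>0\<close> for a cycle.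
\<close>

lemma H1_eq_span_loops:
  assumes z: "z \<in> verts G" and conn: "\<And>v. v \<in> verts G \<Longrightarrow> \<exists>p. awalk z p v"
  shows "H1 G arev = complex_span (homology_class arev ` loops G z)"
proof
  show "complex_span (homology_class arev ` loops G z) \<subseteq> H1 G arev"
    unfolding complex_span_def
    by (rule complex_chains.span_minimal) (auto intro: subspace_H1 homology_class_in_H1)
next
  obtain T where T: "\<And>v. v \<in> verts G \<Longrightarrow> awalk z (T v) v" using conn by metis
  define loop where "loop a = T (tail G a) @ [a] @ rev_walk (T (head G a))" for a
  have loop: "loop a \<in> loops G z" if a: "a \<in> arcs G" for a
  proof -
    have "awalk (tail G a) [a] (head G a)" using a by (simp add: awalk_simps)
    then show ?thesis
      using T[of "tail G a"] awalk_rev_walk[OF T[of "head G a"]] a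
      unfolding loop_def loops_def mem_Collect_eq by (intro awalk_appendI) auto
  qed
  show "H1 G arev \<subseteq> complex_span (homology_class arev ` loops G z)"
  proof
    fix c assume "c \<in> H1 G arev"
    then have out: "\<And>a. a \<notin> arcs G \<Longrightarrow> c a = 0" and anti: "\<And>a. a \<in> arcs G \<Longrightarrow> c (arev a) = - c a"
      and cycle: "\<And>v. v \<in> verts G \<Longrightarrow> (\<Sum>a\<in>in_arcs G v. c a) = 0"
      by (auto simp: H1_def chains1_def boundary1_def)
    \<comment> \<open>The claimed decomposition of \<open>c\<close> into loops, evaluated at the arc \<open>b\<close>.\<close>
    have eq: "c b = (\<Sum>a\<in>arcs G. c a / 2 * homology_class arev (loop a) b)" for b
    proof -
      define t where "t v = homology_class arev (T v) b" for v
      \<comment> \<open>Both families of connecting walks cancel: grouped by heads, the coefficient of \<open>T v\<close> is the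
        boundary of \<open>c\<close> at \<open>v\<close>; reversing all arcs exchanges heads and tails.\<close>
      have head0: "(\<Sum>a\<in>arcs G. c a * t (head G a)) = 0"
      proof -
        have "(\<Sum>a\<in>arcs G. c a * t (head G a)) = (\<Sum>v\<in>verts G. (\<Sum>a\<in>in_arcs G v. c a) * t v)"
          unfolding sum_arcs_by_head sum_distrib_right by (intro sum.cong) auto
        then show ?thesis by (simp add: cycle)
      qed
      have "(\<Sum>a\<in>arcs G. c a * t (tail G a)) = (\<Sum>a\<in>arcs G. c (arev a) * t (tail G (arev a)))"
        by (rule sum.reindex_bij_witness[of _ arev arev]) auto
      also have "\<dots> = - (\<Sum>a\<in>arcs G. c a * t (head G a))"
        unfolding sum_negf[symmetric] by (intro sum.cong) (auto simp: anti)
      finally have tail0: "(\<Sum>a\<in>arcs G. c a * t (tail G a)) = 0" using head0 by simp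
      have arc: "(\<Sum>a\<in>arcs G. c a * homology_class arev [a] b) = 2 * c b"
      proof (cases "b \<in> arcs G")
        case True
        have "c a * homology_class arev [a] b =
            (if a = b then c a else 0) - (if a = arev b then c a else 0)" for a
          by (auto simp: homology_class_arc of_bool_def)
        then show ?thesis using True by (simp add: sum_subtractf anti)
      next
        case False
        then have "homology_class arev [a] b = 0" if "a \<in> arcs G" for a
          using that arev_in_arcs[OF that] by (auto simp: homology_class_arc of_bool_def)
        then show ?thesis using False out by simp
      qed
      have loop_value: "homology_class arev (loop a) b =
          t (tail G a) + homology_class arev [a] b - t (head G a)" for a
        unfolding loop_def homology_class_append homology_class_rev_walk t_def by simp
      have "(\<Sum>a\<in>arcs G. c a / 2 * homology_class arev (loop a) b) =
          (\<Sum>a\<in>arcs G. (c a * t (tail G a) + c a * homology_class arev [a] b - c a * t (head G a)) / 2)"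
        by (rule sum.cong[OF HOL.refl], subst loop_value, simp add: algebra_simps)
      also have "\<dots> = ((\<Sum>a\<in>arcs G. c a * t (tail G a)) + (\<Sum>a\<in>arcs G. c a * homology_class arev [a] b)
            - (\<Sum>a\<in>arcs G. c a * t (head G a))) / 2"
        by (simp only: sum_divide_distrib[symmetric] sum.distrib sum_subtractf)
      finally show ?thesis using tail0 head0 arc by simp
    qed
    have "c = (\<Sum>a\<in>arcs G. (\<lambda>b. c a / 2 * homology_class arev (loop a) b))"
    proof
      fix b
      have pointwise: "(\<Sum>a\<in>A. (\<lambda>b. c a / 2 * homology_class arev (loop a) b)) b =
          (\<Sum>a\<in>A. c a / 2 * homology_class arev (loop a) b)" for A
        by (induction A rule: infinite_finite_induct) auto
      show "c b = (\<Sum>a\<in>arcs G. (\<lambda>b. c a / 2 * homology_class arev (loop a) b)) b"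
        unfolding pointwise by (rule eq)
    qed
    also have "\<dots> \<in> complex_span (homology_class arev ` loops G z)"
      unfolding complex_span_def using loop
      by (intro complex_chains.span_sum complex_chains.span_scale complex_chains.span_base imageI)
    finally show "c \<in> complex_span (homology_class arev ` loops G z)" .
  qed
qed

end

section \<open>Lifts of walks and their chains\<close>

locale graph_cover = Z: bidirected_digraph Z rz + X: bidirected_digraph X rx
  for Z :: "('c, 'd) pre_digraph" and rz and X :: "('a, 'b) pre_digraph" and rx +
  fixes f :: "('c \<Rightarrow> 'a) \<times> ('d \<Rightarrow> 'b)"
  assumes covering: "covering_map Z rz X rx f"
begin

lemma proj_arc:
  assumes "e \<in> arcs Z"
  shows "snd f e \<in> arcs X" "tail X (snd f e) = fst f (tail Z e)"
    "head X (snd f e) = fst f (head Z e)" "snd f (rz e) = rx (snd f e)"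
  using assms covering by (auto simp: covering_map_def graph_map_def)

lemma proj_awalk: "Z.awalk z q z' \<Longrightarrow> X.awalk (fst f z) (map (snd f) q) (fst f z')"
  using covering
  by (induction q arbitrary: z)
    (auto simp: Z.awalk_simps X.awalk_simps proj_arc covering_map_def)

lemma lift_arc_unique:
  assumes "e \<in> arcs Z" "e' \<in> arcs Z" "tail Z e = tail Z e'" "snd f e = snd f e'"
  shows "e = e'"
proof -
  have "inj_on (snd f) (out_arcs Z (tail Z e))"
    using covering assms(1) by (auto simp: covering_map_def bij_betw_def)
  then show ?thesis using assms by (auto dest: inj_onD)
qed

lemma lift_arc:
  assumes "z \<in> verts Z" "a \<in> arcs X" "tail X a = fst f z"
  obtains e where "e \<in> arcs Z" "tail Z e = z" "snd f e = a"
proof -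
  have "snd f ` out_arcs Z z = out_arcs X (fst f z)"
    using covering assms(1) by (auto simp: covering_map_def bij_betw_def)
  then have "a \<in> snd f ` out_arcs Z z" using assms by auto
  then show ?thesis using that by auto
qed

lemma lift_awalk_unique:
  "Z.awalk z q z1 \<Longrightarrow> Z.awalk z q' z2 \<Longrightarrow> map (snd f) q = map (snd f) q' \<Longrightarrow> q = q' \<and> z1 = z2"
proof (induction q arbitrary: z q')
  case Nil
  then show ?case by (auto simp: Z.awalk_simps)
next
  case (Cons e q)
  then obtain e' r where q': "q' = e' # r" by (cases q') auto
  have "e = e'" using Cons.prems q' by (intro lift_arc_unique) (auto simp: Z.awalk_Cons_iff)
  then show ?case using Cons q' by (auto simp: Z.awalk_Cons_iff)
qed

text \<open>
  A walk \<open>p\<close> downstairs has at most one lift starting at \<open>z\<close>. The relation records the two data about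
  this lift that depend only on the homotopy class of \<open>p\<close>, namely its end \<open>z'\<close> and its chain \<open>c\<close>; the
  lift itself does not.
\<close>

definition lift_class :: "'c \<Rightarrow> 'b list \<Rightarrow> 'c \<Rightarrow> ('d \<Rightarrow> complex) \<Rightarrow> bool" where
  "lift_class z p z' c \<longleftrightarrow> (\<exists>q. Z.awalk z q z' \<and> map (snd f) q = p \<and> homology_class rz q = c)"

lemma lift_class_append:
  "lift_class z (p @ p') z' c \<longleftrightarrow>
     (\<exists>w c1 c2. lift_class z p w c1 \<and> lift_class w p' z' c2 \<and> c = c1 + c2)"
proof
  assume "lift_class z (p @ p') z' c"
  then obtain q where q: "Z.awalk z q z'" "map (snd f) q = p @ p'" "homology_class rz q = c"
    by (auto simp: lift_class_def)
  then obtain q1 q2 where split: "q = q1 @ q2" "map (snd f) q1 = p" "map (snd f) q2 = p'"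
    by (auto simp: map_eq_append_conv)
  then obtain w where "Z.awalk z q1 w" "Z.awalk w q2 z'"
    using q(1) unfolding split(1) Z.awalk_append_iff_ex by blast
  moreover have "c = homology_class rz q1 + homology_class rz q2"
    using q(3) unfolding split(1) Z.homology_class_append by simp
  ultimately show "\<exists>w c1 c2. lift_class z p w c1 \<and> lift_class w p' z' c2 \<and> c = c1 + c2"
    using split unfolding lift_class_def by blast
next
  assume "\<exists>w c1 c2. lift_class z p w c1 \<and> lift_class w p' z' c2 \<and> c = c1 + c2"
  then obtain w q1 q2 where "Z.awalk z q1 w" "Z.awalk w q2 z'" "map (snd f) q1 = p"
    "map (snd f) q2 = p'" "c = homology_class rz q1 + homology_class rz q2"
    by (auto simp: lift_class_def)
  then show "lift_class z (p @ p') z' c"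
    using Z.awalk_appendI[of z q1 w q2 z'] Z.homology_class_append[of q1 q2]
    unfolding lift_class_def by (intro exI[of _ "q1 @ q2"]) simp
qed

lemma lift_class_unique:
  assumes "lift_class z p z1 c1" "lift_class z p z2 c2"
  shows "z1 = z2 \<and> c1 = c2"
proof -
  obtain q q' where "Z.awalk z q z1" "map (snd f) q = p" "homology_class rz q = c1"
    "Z.awalk z q' z2" "map (snd f) q' = p" "homology_class rz q' = c2"
    using assms unfolding lift_class_def by blast
  then show ?thesis using lift_awalk_unique[of z q z1 q' z2] by simp
qed

lemma lift_class_verts:
  "lift_class z p z' c \<Longrightarrow> z \<in> verts Z \<and> z' \<in> verts Z"
  by (auto simp: lift_class_def)

lemma lift_class_proj:
  "lift_class z p z' c \<Longrightarrow> X.awalk (fst f z) p (fst f z')"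
  using proj_awalk by (auto simp: lift_class_def)

lemma lift_class_rev_walk:
  assumes "lift_class z p z' c"
  shows "lift_class z' (X.rev_walk p) z (- c)"
proof -
  from assms obtain q where q: "Z.awalk z q z'" "map (snd f) q = p" "homology_class rz q = c"
    by (auto simp: lift_class_def)
  have "map (snd f) (Z.rev_walk q) = X.rev_walk (map (snd f) q)" if "set q \<subseteq> arcs Z"
    using that by (induction q) (auto simp: proj_arc)
  then show ?thesis
    using q Z.awalk_rev_walk[OF q(1)] Z.homology_class_rev_walk[of q]
    unfolding lift_class_def by (intro exI[of _ "Z.rev_walk q"]) auto
qed

lemma lift_class_backtrack:
  assumes "a \<in> arcs X"
  shows "lift_class z [a, rx a] z' c \<longleftrightarrow> z \<in> verts Z \<and> fst f z = tail X a \<and> z' = z \<and> c = 0"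
proof -
  have ex: "lift_class z [a, rx a] z 0" if v: "z \<in> verts Z" "fst f z = tail X a"
  proof -
    obtain e where e: "e \<in> arcs Z" "tail Z e = z" "snd f e = a"
      using lift_arc[OF v(1) assms v(2)[symmetric]] by blast
    have "homology_class rz [e, rz e] = 0" by (auto simp: homology_class_def fun_eq_iff Z.arev_eq_iff)
    then show ?thesis
      using e v(1) unfolding lift_class_def
      by (intro exI[of _ "[e, rz e]"]) (simp add: Z.awalk_simps proj_arc)
  qed
  show ?thesis
  proof
    assume l: "lift_class z [a, rx a] z' c"
    then have z: "z \<in> verts Z" "fst f z = tail X a"
      using lift_class_verts[OF l] lift_class_proj[OF l] by (simp_all add: X.awalk_Cons_iff)
    with lift_class_unique[OF l ex[OF z]] show "z \<in> verts Z \<and> fst f z = tail X a \<and> z' = z \<and> c = 0"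
      by simp
  next
    assume "z \<in> verts Z \<and> fst f z = tail X a \<and> z' = z \<and> c = 0"
    then show "lift_class z [a, rx a] z' c" using ex by simp
  qed
qed

text \<open>
  An inserted backtrack lifts to a backtrack, which returns to its start and has chain \<open>0\<close>. The
  assumption on \<open>z\<close> matters for the empty loop, which lifts to every vertex of \<open>Z\<close>, whereas a
  backtrack based at \<open>x\<close> lifts only to vertices over \<open>x\<close>.
\<close>

lemma lift_class_homotopic:
  assumes "loop_homotopic X rx x p p'" "fst f z = x"
  shows "lift_class z p z' c \<longleftrightarrow> lift_class z p' z' c"
  using assms(1)
proof (induction rule: loop_homotopic.induct)
  case (backtrack p q a)
  from backtrack(2) have a: "a \<in> arcs X" and p: "X.awalk x p (tail X a)"
    by (auto simp: loops_def X.awalk_append_iff_ex X.awalk_simps simp del: X.awalk_append_iff)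
  have "w \<in> verts Z \<and> fst f w = tail X a" if l: "lift_class z p w c1" for w c1
    using lift_class_proj[OF l] lift_class_verts[OF l] p assms(2)
      X.awalk_end_unique[of x p "tail X a" "fst f w"] by simp
  then show ?case
    unfolding lift_class_append lift_class_backtrack[OF a] by fastforce
qed auto

end

section \<open>Regular covers and primitive homology\<close>

locale regular_graph_cover = graph_cover +
  assumes regular: "regular_cover Z rz X rx f"
begin

text \<open>
  Deck transformations carry one closed lift to a closed lift at any other vertex of the fibre.
\<close>

lemma closed_lift_everywhere:
  assumes "lift_class z p z c" "z' \<in> verts Z" "fst f z' = fst f z"
  shows "\<exists>c'. lift_class z' p z' c'"
proof -
  have z: "z \<in> verts Z" using assms(1) lift_class_verts by blast
  then obtain g where g: "deck_transformation Z rz f g" "fst g z = z'"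
    using regular assms(2,3) unfolding regular_cover_def by metis
  have walk: "Z.awalk (fst g v) (map (snd g) q) (fst g v')" if "Z.awalk v q v'" for v q v'
    using that g(1)
    by (induction q arbitrary: v)
      (auto simp: Z.awalk_simps deck_transformation_def graph_map_def)
  have proj: "map (snd f) (map (snd g) q) = map (snd f) q" if "set q \<subseteq> arcs Z" for q
    using that g(1) by (auto simp: deck_transformation_def)
  from assms(1) obtain q where q: "Z.awalk z q z" "map (snd f) q = p"
    by (auto simp: lift_class_def)
  then have "set q \<subseteq> arcs Z" by auto
  then show ?thesis
    using walk[OF q(1)] proj[of q] q(2) g(2) unfolding lift_class_def by metis
qed

text \<open>
  Every lift of the loop \<open>\<rho> a\<close> is closed, so skipping the occurrences of \<open>a\<close> in a word leaves the
  rest of the lift unchanged. Only the chains of the omitted lifts are lost, and these lie in \<open>P\<close>.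
\<close>

lemma lift_class_delete_letter:
  assumes P: "complex_chains.subspace P"
    and \<rho>: "\<And>s. s \<in> S \<Longrightarrow> \<rho> s \<in> loops X x"
    and a: "\<And>z z' c. fst f z = x \<Longrightarrow> lift_class z (\<rho> a) z' c \<Longrightarrow> z' = z \<and> c \<in> P"
    and "set w \<subseteq> S \<times> UNIV" "fst f z = x" "lift_class z (X.word_loop \<rho> w) z' c"
  shows "\<exists>c'. lift_class z (X.word_loop \<rho> (filter (\<lambda>l. fst l \<noteq> a) w)) z' c' \<and> c - c' \<in> P"
  using assms(4-)
proof (induction w arbitrary: z c)
  case Nil
  have "c - c \<in> P" using complex_chains.subspace_0[OF P] by (simp only: diff_self)
  then show ?case using Nil.prems(3) by (intro exI[of _ c] conjI) (simp_all only: filter.simps)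
next
  case (Cons l w)
  obtain s b where l: "l = (s, b)" by (cases l)
  define p where "p = (if b then \<rho> s else X.rev_walk (\<rho> s))"
  have loop: "p \<in> loops X x" using \<rho> Cons.prems(1) l by (auto simp: p_def X.rev_walk_loops)
  obtain z1 c1 c2 where c1: "lift_class z p z1 c1" and c2: "lift_class z1 (X.word_loop \<rho> w) z' c2"
    and c: "c = c1 + c2"
    using Cons.prems(3) unfolding l X.word_loop_simps lift_class_append p_def by blast
  have z1: "fst f z1 = x"
    using lift_class_proj[OF c1] loop Cons.prems(2) X.awalk_ends_eqD
    by (metis loops_def mem_Collect_eq)
  have wS: "set w \<subseteq> S \<times> UNIV" using Cons.prems(1) by simp
  obtain c2' where c2': "lift_class z1 (X.word_loop \<rho> (filter (\<lambda>l. fst l \<noteq> a) w)) z' c2'"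
    and diff: "c2 - c2' \<in> P"
    using Cons.IH[OF wS z1 c2] by blast
  show ?case
  proof (cases "s = a")
    case False
    have "lift_class z (p @ X.word_loop \<rho> (filter (\<lambda>l. fst l \<noteq> a) w)) z' (c1 + c2')"
      unfolding lift_class_append using c1 c2' by blast
    moreover have "X.word_loop \<rho> (filter (\<lambda>l. fst l \<noteq> a) (l # w)) =
        p @ X.word_loop \<rho> (filter (\<lambda>l. fst l \<noteq> a) w)"
      using False by (simp add: l p_def)
    moreover have "c - (c1 + c2') = c2 - c2'" unfolding c by (rule add_diff_cancel_left)
    ultimately show ?thesis using diff by metis
  next
    case True
    \<comment> \<open>The letter may stand for \<open>\<rho> a\<close> or for its reverse; the lift of the reverse from \<open>z\<close> to \<open>z1\<close>,
      traversed backwards, is a lift of \<open>\<rho> a\<close> from \<open>z1\<close> to \<open>z\<close>.\<close>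
    have "z1 = z \<and> c1 \<in> P"
    proof (cases b)
      case True
      then show ?thesis using a[of z z1 c1] c1 \<open>s = a\<close> Cons.prems(2) by (simp add: p_def)
    next
      case False
      then have "lift_class z1 (\<rho> a) z (- c1)"
        using lift_class_rev_walk[OF c1] \<open>s = a\<close> by (simp add: p_def)
      then show ?thesis using a[of z1 z "- c1"] z1 complex_chains.subspace_neg[OF P, of "- c1"] by simp
    qed
    then have "z1 = z" and "c1 + (c2 - c2') \<in> P"
      using complex_chains.subspace_add[OF P _ diff] by blast+
    moreover have "c - c2' = c1 + (c2 - c2')" unfolding c by (rule add_diff_eq[symmetric])
    moreover have "filter (\<lambda>l. fst l \<noteq> a) (l # w) = filter (\<lambda>l. fst l \<noteq> a) w"
      using True by (simp add: l)
    ultimately show ?thesis using c2' by metis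
  qed
qed

text \<open>
  A closed lift of the loop itself is an elevation with exponent \<open>1\<close>.
\<close>

lemma lift_class_primitive_in_H1_prim:
  assumes "primitive_loop X rx x p" "fst f z = x" "lift_class z p z c"
  shows "c \<in> H1_prim Z rz X rx f"
proof -
  obtain q where q: "Z.awalk z q z" "map (snd f) q = p" "homology_class rz q = c"
    using assms(3) by (auto simp: lift_class_def)
  then have "closed_lift Z f x (loop_power p 1) z q"
    using assms(2) by (simp add: closed_lift_def loop_power_def loops_def)
  then have "elevation Z f x p q" unfolding elevation_def by (intro exI[of _ 1]) auto
  then show ?thesis
    unfolding H1_prim_def complex_span_def using assms(1) q(3)
    by (intro complex_chains.span_base) blast
qed

text \<open>
  The core of the argument. Write the image of \<open>q\<close> as a word in a free basis containing the class \<open>a\<close>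
  of \<open>p\<close>, and let \<open>w\<close> be this word without its letters \<open>a\<close>. Modulo primitive homology, \<open>q\<close> is
  homologous to the lift of \<open>w\<close> at \<open>z\<close>, which is again closed. By the transvection lemma \<open>a w\<close> is
  primitive, and it lifts to a closed loop, namely the lift of \<open>a\<close> followed by that of \<open>w\<close>. So the
  lift of \<open>w\<close> represents a difference of two primitive classes.
\<close>

lemma loop_in_H1_prim:
  assumes p: "primitive_loop X rx x p" and z: "fst f z = x" and lift: "lift_class z p z c0"
    and q: "q \<in> loops Z z"
  shows "homology_class rz q \<in> H1_prim Z rz X rx f"
proof -
  let ?H = "pi1 X rx x" and ?P = "H1_prim Z rz X rx f"
  define a where "a = loop_class X rx x p"
  have ploop: "p \<in> loops X x" using p by (simp add: primitive_loop_def)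
  then have x: "x \<in> verts X" by (auto simp: loops_def)
  interpret H: group ?H using x by (rule X.pi1_group)
  obtain S where S: "free_basis ?H S" and aS: "a \<in> S"
    using p by (auto simp: primitive_loop_def a_def)
  have "\<forall>s\<in>S. \<exists>r. r \<in> loops X x \<and> loop_class X rx x r = s"
    using S by (auto simp: free_basis_def X.pi1_carrier)
  then obtain \<rho> where \<rho>: "\<And>s. s \<in> S \<Longrightarrow> \<rho> s \<in> loops X x \<and> loop_class X rx x (\<rho> s) = s" by metis
  have sub: "complex_chains.subspace ?P"
    unfolding H1_prim_def complex_span_def by (rule complex_chains.subspace_span)
  have prim_a: "primitive_loop X rx x (\<rho> a)"
    using \<rho>[OF aS] S aS by (auto simp: primitive_loop_def)
  have "loop_homotopic X rx x p (\<rho> a)"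
    using \<rho>[OF aS] by (intro X.loop_class_eq_iff[OF ploop, THEN iffD1]) (simp add: a_def)
  then have lift_a: "lift_class z (\<rho> a) z c0" using lift lift_class_homotopic z by blast
  \<comment> \<open>The loop \<open>\<rho> a\<close> lifts closed at \<open>z\<close> because \<open>p\<close> does, hence at the whole fibre by regularity.\<close>
  have closed_a: "v' = v \<and> c \<in> ?P" if v: "fst f v = x" "lift_class v (\<rho> a) v' c" for v v' c
  proof -
    obtain c' where c': "lift_class v (\<rho> a) v c'"
      using closed_lift_everywhere[OF lift_a] lift_class_verts[OF v(2)] v(1) z by auto
    then have "v' = v \<and> c = c'" using lift_class_unique[OF v(2) c'] by simp
    with c' show ?thesis using lift_class_primitive_in_H1_prim[OF prim_a v(1)] by blast
  qed
  define r where "r = map (snd f) q"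
  have walk: "Z.awalk z q z" using q by (simp add: loops_def)
  then have r: "r \<in> loops X x" using proj_awalk z by (auto simp: r_def loops_def)
  then have "loop_class X rx x r \<in> carrier ?H" by (simp add: X.pi1_carrier)
  then have "loop_class X rx x r \<in> word_value ?H ` reduced_words S"
    using S by (simp add: free_basis_def bij_betw_def)
  then obtain u where u: "u \<in> reduced_words S" "word_value ?H u = loop_class X rx x r"
    by (metis imageE)
  then have uS: "set u \<subseteq> S \<times> UNIV" by (simp add: reduced_words_def)
  have "loop_homotopic X rx x r (X.word_loop \<rho> u)"
    using X.word_loop_class[OF x \<rho> uS] u(2)
    by (intro X.loop_class_eq_iff[OF r, THEN iffD1]) simp
  moreover have "lift_class z r z (homology_class rz q)"
    using walk by (auto simp: lift_class_def r_def)
  ultimately have "lift_class z (X.word_loop \<rho> u) z (homology_class rz q)"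
    using lift_class_homotopic z by blast
  then obtain c where
    c: "lift_class z (X.word_loop \<rho> (filter (\<lambda>l. fst l \<noteq> a) u)) z c" "homology_class rz q - c \<in> ?P"
    using lift_class_delete_letter[OF sub, of S \<rho> x a u z z] \<rho> closed_a uS z by blast
  define w where "w = filter (\<lambda>l. fst l \<noteq> a) u"
  have wS: "set w \<subseteq> (S - {a}) \<times> UNIV" using uS by (auto simp: w_def)
  have w: "X.word_loop \<rho> w \<in> loops X x" "loop_class X rx x (X.word_loop \<rho> w) = word_value ?H w"
    using X.word_loop_class[OF x \<rho>, of S w] wS by auto
  have "loop_class X rx x (\<rho> a @ X.word_loop \<rho> w) = a \<otimes>\<^bsub>?H\<^esub> word_value ?H w"
    using X.loop_class_mult[of "\<rho> a" x "X.word_loop \<rho> w"] \<rho>[OF aS] w by simp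
  then have "primitive_loop X rx x (\<rho> a @ X.word_loop \<rho> w)"
    using H.free_basis_transvection[OF S aS wS] X.loops_append w(1) \<rho>[OF aS]
    by (auto simp: primitive_loop_def)
  moreover have "lift_class z (\<rho> a @ X.word_loop \<rho> w) z (c0 + c)"
    using lift_a c(1) by (auto simp: lift_class_append w_def)
  ultimately have "c0 + c \<in> ?P" using lift_class_primitive_in_H1_prim z by blast
  moreover have "c0 \<in> ?P" using closed_a[OF z lift_a] by simp
  ultimately have "(c0 + c) - c0 \<in> ?P" by (rule complex_chains.subspace_diff[OF sub])
  from complex_chains.subspace_add[OF sub c(2) this] show ?thesis
    by (simp only: add_diff_cancel_left' diff_add_cancel)
qed

end

theorem lemma2p4:
  fixes X :: "('a, 'b) pre_digraph" and rx :: "'b \<Rightarrow> 'b"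
    and Z :: "('c, 'd) pre_digraph" and rz :: "'d \<Rightarrow> 'd"
    and f :: "('c \<Rightarrow> 'a) \<times> ('d \<Rightarrow> 'b)"
  assumes "finite_connected_graph X rx"
    and "finite_connected_graph Z rz"
    and "regular_cover Z rz X rx f"
    and "\<exists>x p z q. primitive_loop X rx x p \<and> closed_lift Z f x p z q"
  shows "H1_prim Z rz X rx f = H1 Z rz"
proof -
  interpret X: bidirected_digraph X rx using assms(1) by (simp add: finite_connected_graph_def)
  interpret Zb: bidirected_digraph Z rz using assms(2) by (simp add: finite_connected_graph_def)
  interpret Zf: fin_digraph Z using assms(2) by (simp add: finite_connected_graph_def)
  interpret Z: finite_bidirected_digraph Z rz by unfold_locales
  interpret regular_graph_cover Z rz X rx f
    using assms(3) by unfold_locales (simp_all add: regular_cover_def)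
  obtain x p z q0 where p: "primitive_loop X rx x p" and "closed_lift Z f x p z q0"
    using assms(4) by blast
  then have z: "fst f z = x" and lift: "lift_class z p z (homology_class rz q0)"
    and zZ: "z \<in> verts Z"
    by (auto simp: closed_lift_def loops_def lift_class_def)
  have "\<exists>q. pre_digraph.awalk Z z q v" if v: "v \<in> verts Z" for v
  proof -
    have "z \<rightarrow>\<^sup>*\<^bsub>mk_symmetric Z\<^esub> v"
      using assms(2) zZ v by (auto simp: finite_connected_graph_def connected_def strongly_connected_def)
    then show ?thesis by (simp add: Zb.reachable_mk_symmetric_eq[OF Zb.sym_arcs] Zb.reachable_awalk)
  qed
  then have H1: "H1 Z rz = complex_span (homology_class rz ` loops Z z)"
    using zZ by (intro Z.H1_eq_span_loops)
  show ?thesis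
  proof
    show "H1_prim Z rz X rx f \<subseteq> H1 Z rz"
      unfolding H1_prim_def complex_span_def
      by (rule complex_chains.span_minimal)
        (auto intro: Z.subspace_H1 Z.homology_class_in_H1 simp: elevation_def closed_lift_def)
    show "H1 Z rz \<subseteq> H1_prim Z rz X rx f"
      unfolding H1 complex_span_def
    proof (rule complex_chains.span_minimal)
      show "homology_class rz ` loops Z z \<subseteq> H1_prim Z rz X rx f"
        using loop_in_H1_prim[OF p z lift] by blast
      show "complex_chains.subspace (H1_prim Z rz X rx f)"
        unfolding H1_prim_def complex_span_def by (rule complex_chains.subspace_span)
    qed
  qed
qed

end
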